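(* For all integers $m \geq 0$, \begin{align*} rd_o(2m) - rd_e(2m) &= \sum_{n = 0}^\infty \binom{n}{m - n - 1}\left(\binom{n}{m -n} - \binom{n}{m - n - 1}\right), \\ rd_o(2m + 1) - rd_e(2m + 1) &= \sum_{n = 0}^\infty \binom{n}{m - n}\left(\binom{n}{m - n}-\binom{n}{m - n - 1}\right). \end{align*}
   Context: An integer partition is a weakly decreasing finite sequence $\mu = (\mu_1, \ldots, \mu_m)$ of positive integers (its parts); $\ell(\mu) := m$ is its length. The perimeter of a nonempty partition $\mu$ is $P(\mu) := \mu_1 + \ell(\mu) - 1$; the empty partition is not counted. $rd_o(n)$ is the number of partitions with perimeter $n$ into distinct parts that have more odd parts than even parts, and $rd_e(n)$ is the number of partitions with perimeter $n$ into distinct parts that have more even parts than odd parts. For an integer $n \geq 0$ and an integer $r$, $\binom{n}{r} = 0$ if $r < 0$ or $r > n$. *)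

theory Defs
  imports Complex_Main
begin

definition is_partition :: "nat list \<Rightarrow> bool" where
  "is_partition \<mu> \<longleftrightarrow> sorted_wrt (\<ge>) \<mu> \<and> (\<forall>x\<in>set \<mu>. 0 < x)"

text \<open>Only meaningful for nonempty \<open>\<mu>\<close>, where the subtraction does not truncate.\<close>
definition perimeter :: "nat list \<Rightarrow> nat" where
  "perimeter \<mu> = hd \<mu> + length \<mu> - 1"

definition odd_parts :: "nat list \<Rightarrow> nat" where
  "odd_parts \<mu> = length (filter odd \<mu>)"

definition even_parts :: "nat list \<Rightarrow> nat" where
  "even_parts \<mu> = length (filter even \<mu>)"

definition distinct_partitions_perimeter :: "nat \<Rightarrow> nat list set" where
  "distinct_partitions_perimeter n =
     {\<mu>. is_partition \<mu> \<and> \<mu> \<noteq> [] \<and> distinct \<mu> \<and> perimeter \<mu> = n}"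

definition rd_o :: "nat \<Rightarrow> nat" where
  "rd_o n = card {\<mu> \<in> distinct_partitions_perimeter n. odd_parts \<mu> > even_parts \<mu>}"

definition rd_e :: "nat \<Rightarrow> nat" where
  "rd_e n = card {\<mu> \<in> distinct_partitions_perimeter n. even_parts \<mu> > odd_parts \<mu>}"

text \<open>The set counted by \<open>rd_o\<close> and \<open>rd_e\<close> is finite, so \<open>card\<close> is a genuine count.\<close>
lemma finite_distinct_partitions_perimeter: "finite (distinct_partitions_perimeter n)"
proof (rule finite_subset)
  show "distinct_partitions_perimeter n \<subseteq> {\<mu>. set \<mu> \<subseteq> {..n} \<and> length \<mu> \<le> n}"
  proof
    fix \<mu> assume "\<mu> \<in> distinct_partitions_perimeter n"
    then obtain x xs where "\<mu> = x # xs" "is_partition (x # xs)" "perimeter (x # xs) = n"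
      by (cases \<mu>) (auto simp: distinct_partitions_perimeter_def)
    then show "\<mu> \<in> {\<mu>. set \<mu> \<subseteq> {..n} \<and> length \<mu> \<le> n}"
      by (fastforce simp: is_partition_def perimeter_def)
  qed
  show "finite {\<mu>. set \<mu> \<subseteq> {..n} \<and> length \<mu> \<le> n}"
    by (rule finite_lists_length_le) simp
qed

text \<open>Binomial coefficient with an integer lower index; for \<open>r > n\<close> it vanishes because
  \<open>choose\<close> does.\<close>
definition binom :: "nat \<Rightarrow> int \<Rightarrow> int" where
  "binom n r = (if r < 0 then 0 else int (n choose nat r))"

end

theory Submission
  imports Defs
begin

text \<open>Split off the largest part \<open>k\<close> of a partition. The remaining parts form a set of
  \<open>n - k\<close> numbers below \<open>k\<close>, and there are equally many odd and even numbers below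
  \<open>k = 2j + 1\<close>, and one more odd than even ones below \<open>k = 2j + 2\<close>. When both numbers are
  \<open>j\<close>, exchanging the roles of odd and even cancels everything except the choices in which
  the odd and even remaining parts differ in number by at most one. The case \<open>k = 2j + 2\<close> reduces
  to this one by Pascal's rule, with the opposite sign.\<close>

section \<open>Signed sums of products of binomial coefficients\<close>

text \<open>Meant for choosing \<open>r\<close> numbers out of \<open>p\<close> odd and
  \<open>q\<close> even ones: with \<open>a\<close> odd choices the excess of odd over even is
  \<open>a - (r - a)\<close>, and \<open>e\<close> is the contribution of the largest part, 1 if it
  is odd and -1 if it is even.\<close>

definition signed_sum :: "nat \<Rightarrow> nat \<Rightarrow> nat \<Rightarrow> int \<Rightarrow> int" where
  "signed_sum p q r e =
     (\<Sum>a\<le>r. sgn (2 * int a - int r + e) * int (p choose a) * int (q choose (r - a)))"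

text \<open>The substitution of \<open>r - a\<close> for \<open>a\<close> exchanges odd and even
  choices and negates the argument of \<open>sgn\<close>.\<close>

lemma signed_sum_swap: "signed_sum q p r (- e) = - signed_sum p q r e"
proof -
  have "signed_sum q p r (- e)
      = (\<Sum>a\<le>r. sgn (2 * int (r - a) - int r - e) * int (q choose (r - a)) * int (p choose (r - (r - a))))"
    unfolding signed_sum_def by (subst sum.nat_diff_reindex[symmetric, of _ "Suc r", simplified lessThan_Suc_atMost])
      simp
  also have "\<dots> = (\<Sum>a\<le>r. - (sgn (2 * int a - int r + e) * int (p choose a) * int (q choose (r - a))))"
  proof (rule sum.cong[OF refl])
    fix a assume "a \<in> {..r}"
    then have a: "a \<le> r" by simp
    then have "2 * int (r - a) - int r - e = - (2 * int a - int r + e)" by linarith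
    then have "sgn (2 * int (r - a) - int r - e) = - sgn (2 * int a - int r + e)"
      by (simp add: sgn_if)
    then show "sgn (2 * int (r - a) - int r - e) * int (q choose (r - a)) * int (p choose (r - (r - a)))
      = - (sgn (2 * int a - int r + e) * int (p choose a) * int (q choose (r - a)))"
      using a by simp
  qed
  finally show ?thesis by (simp add: signed_sum_def sum_negf)
qed

lemma signed_sum_zero: "signed_sum p p r 0 = 0"
  using signed_sum_swap[of p p r 0] by simp

text \<open>By Pascal's rule the extra odd number changes the sum only by the choices that contain
  it. Its contribution cancels \<open>e = - 1\<close>, and the balanced sum that is left vanishes by
  symmetry.\<close>

lemma signed_sum_Suc: "signed_sum (Suc p) p r (- 1) = - signed_sum p p r 1"
proof (cases r)
  case 0
  then show ?thesis by (simp add: signed_sum_def)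
next
  case (Suc r')
  have "signed_sum (Suc p) p r (- 1) - signed_sum p p r (- 1)
      = (\<Sum>a\<le>Suc r'. sgn (2 * int a - int (Suc r') - 1)
          * (int (Suc p choose a) - int (p choose a)) * int (p choose (Suc r' - a)))"
    unfolding signed_sum_def Suc by (simp add: sum_subtractf[symmetric] algebra_simps)
  \<comment> \<open>The term for \<open>a = 0\<close> vanishes, as both coefficients are 1; after
    the shift by one the argument of \<open>sgn\<close> is \<open>2a - r'\<close>.\<close>
  also have "\<dots> = signed_sum p p r' 0"
    unfolding signed_sum_def by (subst sum.atMost_Suc_shift) (simp add: algebra_simps)
  finally show ?thesis
    using signed_sum_swap[of p p r 1] by (simp add: signed_sum_zero)
qed

text \<open>Averaging the sum with its swapped copy isolates the cancellation: the difference of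
  signs is 2 if \<open>2a = r\<close>, 1 if \<open>2a\<close> and \<open>r\<close> differ by 1, and
  0 otherwise.\<close>

lemma double_signed_sum_one:
  "2 * signed_sum p p r 1 =
     (\<Sum>a\<le>r. (sgn (2 * int a - int r + 1) - sgn (2 * int a - int r - 1))
        * int (p choose a) * int (p choose (r - a)))"
proof -
  have "2 * signed_sum p p r 1 = signed_sum p p r 1 - signed_sum p p r (- 1)"
    using signed_sum_swap[of p p r 1] by simp
  then show ?thesis
    by (simp add: signed_sum_def sum_subtractf[symmetric] algebra_simps)
qed

lemma signed_sum_even: "signed_sum p p (2 * s) 1 = (int (p choose s))\<^sup>2"
proof -
  have "2 * signed_sum p p (2 * s) 1
      = (\<Sum>a\<le>2 * s. if a = s then 2 * (int (p choose s))\<^sup>2 else 0)"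
    unfolding double_signed_sum_one
    by (intro sum.cong refl) (auto simp: sgn_if power2_eq_square split: if_splits)
  then show ?thesis by simp
qed

lemma signed_sum_odd:
  "signed_sum p p (2 * s + 1) 1 = int (p choose s) * int (p choose (s + 1))"
proof -
  let ?c = "int (p choose s) * int (p choose (s + 1))"
  have "2 * signed_sum p p (2 * s + 1) 1
      = (\<Sum>a\<le>2 * s + 1. (if a = s then ?c else 0) + (if a = s + 1 then ?c else 0))"
    unfolding double_signed_sum_one
  proof (intro sum.cong refl)
    fix a
    consider "a < s" | "a = s" | "a = s + 1" | "a > s + 1" by linarith
    then show "(sgn (2 * int a - int (2 * s + 1) + 1) - sgn (2 * int a - int (2 * s + 1) - 1))
        * int (p choose a) * int (p choose (2 * s + 1 - a))
      = (if a = s then ?c else 0) + (if a = s + 1 then ?c else 0)"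
      by cases (auto simp: sgn_if)
  qed
  also have "\<dots> = 2 * ?c" by (simp add: sum.distrib)
  finally show ?thesis by simp
qed

section \<open>Counting subsets by parity\<close>

text \<open>Such a subset amounts to an independent choice of its elements inside and outside the
  class.\<close>

lemma card_subsets_by_class:
  assumes "finite A"
  shows "card {S. S \<subseteq> A \<and> card {x\<in>S. P x} = a \<and> card {x\<in>S. \<not> P x} = b}
    = (card {x\<in>A. P x} choose a) * (card {x\<in>A. \<not> P x} choose b)"
proof -
  let ?X = "{X. X \<subseteq> {x\<in>A. P x} \<and> card X = a}" and ?Y = "{Y. Y \<subseteq> {x\<in>A. \<not> P x} \<and> card Y = b}"
  have "bij_betw (\<lambda>S. ({x\<in>S. P x}, {x\<in>S. \<not> P x}))
      {S. S \<subseteq> A \<and> card {x\<in>S. P x} = a \<and> card {x\<in>S. \<not> P x} = b} (?X \<times> ?Y)"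
  proof (rule bij_betw_byWitness[where f' = "\<lambda>(X, Y). X \<union> Y"], goal_cases)
    case 4
    have "{x \<in> X \<union> Y. P x} = X" "{x \<in> X \<union> Y. \<not> P x} = Y"
      if "X \<in> ?X" "Y \<in> ?Y" for X Y using that by auto
    then show ?case by auto
  qed auto
  then show ?thesis
    using assms by (simp add: bij_betw_same_card card_cartesian_product n_subsets)
qed

text \<open>The sign depends on \<open>S\<close> only through the number \<open>a\<close> of its odd
  elements, so the subsets can be grouped by \<open>a\<close>.\<close>

lemma sum_subsets_sgn:
  assumes "finite A"
  shows "(\<Sum>S | S \<subseteq> A \<and> card S = r.
            sgn (int (card {x\<in>S. odd x}) - int (card {x\<in>S. even x}) + e))
    = signed_sum (card {x\<in>A. odd x}) (card {x\<in>A. even x}) r e"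
proof -
  let ?F = "{S. S \<subseteq> A \<and> card S = r}"
  have split: "card {x\<in>S. odd x} + card {x\<in>S. even x} = card S" if "S \<subseteq> A" for S
  proof -
    have "finite S" using assms that finite_subset by blast
    moreover have "S = {x\<in>S. odd x} \<union> {x\<in>S. even x}" by auto
    ultimately show ?thesis
      by (metis (no_types, lifting) card_Un_disjoint disjoint_iff finite_Un mem_Collect_eq)
  qed
  have "(\<Sum>S\<in>?F. sgn (int (card {x\<in>S. odd x}) - int (card {x\<in>S. even x}) + e))
    = (\<Sum>a\<le>r. \<Sum>S | S \<in> ?F \<and> card {x\<in>S. odd x} = a.
            sgn (int (card {x\<in>S. odd x}) - int (card {x\<in>S. even x}) + e))"
  proof (rule sum.group[symmetric])
    show "finite ?F" using assms by simp
    show "(\<lambda>S. card {x\<in>S. odd x}) ` ?F \<subseteq> {..r}" by (auto dest: split)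
  qed simp
  also have "\<dots> = (\<Sum>a\<le>r. sgn (2 * int a - int r + e)
      * int (card {x\<in>A. odd x} choose a) * int (card {x\<in>A. even x} choose (r - a)))"
  proof (rule sum.cong[OF refl])
    fix a assume a: "a \<in> {..r}"
    let ?G = "{S. S \<in> ?F \<and> card {x\<in>S. odd x} = a}"
    have G: "?G = {S. S \<subseteq> A \<and> card {x\<in>S. odd x} = a \<and> card {x\<in>S. \<not> odd x} = r - a}"
      using a by (auto dest: split)
    have "(\<Sum>S\<in>?G. sgn (int (card {x\<in>S. odd x}) - int (card {x\<in>S. even x}) + e))
        = (\<Sum>S\<in>?G. sgn (2 * int a - int r + e))"
    proof (rule sum.cong[OF refl])
      fix S assume "S \<in> ?G"
      then have "card {x\<in>S. odd x} = a" "card {x\<in>S. even x} = r - a" unfolding G by auto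
      with a show "sgn (int (card {x\<in>S. odd x}) - int (card {x\<in>S. even x}) + e)
          = sgn (2 * int a - int r + e)" by (simp add: of_nat_diff algebra_simps)
    qed
    also have "\<dots> = int (card ?G) * sgn (2 * int a - int r + e)" by simp
    also have "card ?G = (card {x\<in>A. odd x} choose a) * (card {x\<in>A. even x} choose (r - a))"
      unfolding G card_subsets_by_class[OF assms] by simp
    finally show "(\<Sum>S\<in>?G. sgn (int (card {x\<in>S. odd x}) - int (card {x\<in>S. even x}) + e))
      = sgn (2 * int a - int r + e)
      * int (card {x\<in>A. odd x} choose a) * int (card {x\<in>A. even x} choose (r - a))"
      by simp
  qed
  finally show ?thesis by (simp add: signed_sum_def)
qed

section \<open>From partitions to signed sums\<close>

lemma odd_parts_eq_card: "distinct \<mu> \<Longrightarrow> odd_parts \<mu> = card {x\<in>set \<mu>. odd x}"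
  unfolding odd_parts_def by (metis distinct_card distinct_filter set_filter)

lemma even_parts_eq_card: "distinct \<mu> \<Longrightarrow> even_parts \<mu> = card {x\<in>set \<mu>. even x}"
  unfolding even_parts_def by (metis distinct_card distinct_filter set_filter)

text \<open>Partitions with equally many odd and even parts contribute
  \<open>sgn 0 = 0\<close>.\<close>

lemma rd_diff_eq_sum_sgn:
  "int (rd_o n) - int (rd_e n)
     = (\<Sum>\<mu>\<in>distinct_partitions_perimeter n. sgn (int (odd_parts \<mu>) - int (even_parts \<mu>)))"
proof -
  let ?D = "distinct_partitions_perimeter n"
  have "(\<Sum>\<mu>\<in>?D. sgn (int (odd_parts \<mu>) - int (even_parts \<mu>)))
      = (\<Sum>\<mu>\<in>?D. of_bool (odd_parts \<mu> > even_parts \<mu>) - of_bool (even_parts \<mu> > odd_parts \<mu>))"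
    by (intro sum.cong refl) (auto simp: sgn_if)
  also have "\<dots> = int (rd_o n) - int (rd_e n)"
    unfolding rd_o_def rd_e_def using finite_distinct_partitions_perimeter[of n]
    by (simp add: sum_subtractf of_bool_def sum.If_cases Int_def)
  finally show ?thesis by simp
qed

lemma sorted_desc_unique:
  fixes xs ys :: "nat list"
  assumes "sorted_wrt (\<ge>) xs" "distinct xs" "sorted_wrt (\<ge>) ys" "distinct ys" "set xs = set ys"
  shows "xs = ys"
  using sorted_distinct_set_unique[of "rev xs" "rev ys"] assms
  by (simp add: sorted_wrt_rev)

text \<open>A partition into distinct parts is its largest part \<open>k\<close> together with the
  set \<open>S\<close> of the others, listed in decreasing order. Its perimeter is
  \<open>k + (card S + 1) - 1\<close>, which forces \<open>card S = n - k\<close>.\<close>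

lemma sum_distinct_partitions_perimeter:
  "(\<Sum>\<mu>\<in>distinct_partitions_perimeter n. f (set \<mu>))
     = (\<Sum>k=1..n. \<Sum>S | S \<subseteq> {1..<k} \<and> card S = n - k. f (insert k S))"
proof -
  let ?B = "SIGMA k:{1..n}. {S. S \<subseteq> {1..<k} \<and> card S = n - k}"
  have "(\<Sum>\<mu>\<in>distinct_partitions_perimeter n. f (set \<mu>)) = (\<Sum>(k, S)\<in>?B. f (insert k S))"
  proof (rule sum.reindex_bij_witness[where j = "\<lambda>\<mu>. (hd \<mu>, set (tl \<mu>))"
        and i = "\<lambda>(k, S). k # rev (sorted_list_of_set S)"], goal_cases)
    case (1 \<mu>)
    then obtain k \<nu> where \<mu>: "\<mu> = k # \<nu>" by (cases \<mu>) (auto simp: distinct_partitions_perimeter_def)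
    with 1 have \<nu>: "sorted_wrt (\<ge>) \<nu>" "distinct \<nu>"
      by (auto simp: distinct_partitions_perimeter_def is_partition_def)
    have "rev (sorted_list_of_set (set \<nu>)) = \<nu>"
      by (rule sorted_desc_unique) (use \<nu> in \<open>auto simp: sorted_wrt_rev\<close>)
    then show ?case by (simp add: \<mu>)
  next
    case (2 \<mu>)
    then obtain k \<nu> where \<mu>: "\<mu> = k # \<nu>" by (cases \<mu>) (auto simp: distinct_partitions_perimeter_def)
    with 2 have *: "\<forall>x\<in>set \<nu>. x \<le> k \<and> 0 < x" "0 < k" "k \<notin> set \<nu>" "distinct \<nu>" "k + length \<nu> = n"
      by (auto simp: distinct_partitions_perimeter_def is_partition_def perimeter_def)
    then have "set \<nu> \<subseteq> {1..<k}" by (fastforce simp: le_less)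
    with * show ?case by (auto simp: \<mu> distinct_card)
  next
    case (3 b)
    then obtain k S where b: "b = (k, S)" and S: "S \<subseteq> {1..<k}" by auto
    then have "finite S" using finite_subset by blast
    then show ?case by (simp add: b)
  next
    case (4 b)
    then obtain k S where b: "b = (k, S)" and k: "1 \<le> k" "k \<le> n" and S: "S \<subseteq> {1..<k}" "card S = n - k"
      by auto
    have "finite S" using S finite_subset by blast
    with k S show ?case
      by (force simp: b distinct_partitions_perimeter_def is_partition_def perimeter_def sorted_wrt_rev)
  next
    case (5 \<mu>)
    then show ?case by (cases \<mu>) (auto simp: distinct_partitions_perimeter_def)
  qed
  also have "\<dots> = (\<Sum>k=1..n. \<Sum>S | S \<subseteq> {1..<k} \<and> card S = n - k. f (insert k S))"
    by (rule sum.Sigma[symmetric]) auto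
  finally show ?thesis .
qed

lemma rd_diff_eq_sum_signed_sum:
  "int (rd_o n) - int (rd_e n)
     = (\<Sum>k=1..n. signed_sum (card {x\<in>{1..<k}. odd x}) (card {x\<in>{1..<k}. even x}) (n - k)
                    (if odd k then 1 else - 1))"
proof -
  let ?w = "\<lambda>S e. sgn (int (card {x\<in>S. odd x}) - int (card {x\<in>S. even x}) + e)"
  \<comment> \<open>Inserting \<open>k\<close> moves the excess of odd over even by one, and this
    becomes the shift \<open>e\<close>.\<close>
  have ins: "?w (insert k S) 0 = ?w S (if odd k then 1 else - 1)"
    if "S \<subseteq> {1..<k}" for k :: nat and S
  proof -
    have "finite S" using that by (rule finite_subset) simp
    moreover have "k \<notin> S" using that by auto
    moreover have "{x\<in>insert k S. Q x} = (if Q k then insert k {x\<in>S. Q x} else {x\<in>S. Q x})" for Q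
      by auto
    ultimately show ?thesis by (simp add: algebra_simps)
  qed
  have "int (rd_o n) - int (rd_e n) = (\<Sum>\<mu>\<in>distinct_partitions_perimeter n. ?w (set \<mu>) 0)"
    unfolding rd_diff_eq_sum_sgn
    by (intro sum.cong refl)
      (simp add: distinct_partitions_perimeter_def odd_parts_eq_card even_parts_eq_card)
  also have "\<dots> = (\<Sum>k=1..n. \<Sum>S | S \<subseteq> {1..<k} \<and> card S = n - k. ?w (insert k S) 0)"
    by (rule sum_distinct_partitions_perimeter)
  also have "\<dots> = (\<Sum>k=1..n. \<Sum>S | S \<subseteq> {1..<k} \<and> card S = n - k. ?w S (if odd k then 1 else - 1))"
    by (intro sum.cong refl ins) simp
  finally show ?thesis by (simp add: sum_subsets_sgn)
qed

section \<open>Pairing the largest parts \<open>2j + 1\<close> and \<open>2j + 2\<close>\<close>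

lemma card_odd_even_less:
  "card {x\<in>{1..<2 * j + 1}. odd x} = j \<and> card {x\<in>{1..<2 * j + 1}. even x} = j"
proof (induction j)
  case 0
  then show ?case by simp
next
  case (Suc j)
  have "{1..<2 * Suc j + 1} = insert (2 * j + 2) (insert (2 * j + 1) {1..<2 * j + 1})" by auto
  then have "{x\<in>{1..<2 * Suc j + 1}. odd x} = insert (2 * j + 1) {x\<in>{1..<2 * j + 1}. odd x}"
    "{x\<in>{1..<2 * Suc j + 1}. even x} = insert (2 * j + 2) {x\<in>{1..<2 * j + 1}. even x}"
    by auto
  with Suc show ?case by simp
qed

lemma card_odd_even_less_Suc:
  "card {x\<in>{1..<2 * j + 2}. odd x} = Suc j \<and> card {x\<in>{1..<2 * j + 2}. even x} = j"
proof -
  have "{1..<2 * j + 2} = insert (2 * j + 1) {1..<2 * j + 1}" by auto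
  then have "{x\<in>{1..<2 * j + 2}. odd x} = insert (2 * j + 1) {x\<in>{1..<2 * j + 1}. odd x}"
    "{x\<in>{1..<2 * j + 2}. even x} = {x\<in>{1..<2 * j + 1}. even x}"
    by auto
  with card_odd_even_less[of j] show ?thesis by simp
qed

lemma sum_odd_even_pairs:
  fixes f :: "nat \<Rightarrow> 'a::comm_monoid_add"
  shows "(\<Sum>k=1..2 * m. f k) = (\<Sum>j<m. f (2 * j + 1) + f (2 * j + 2))"
  by (induction m) (simp_all add: add.assoc)

text \<open>Each pair of largest parts reduces to sums over \<open>j\<close> odd and
  \<open>j\<close> even numbers, with an odd number of remaining parts for \<open>2j + 1\<close> and
  an even one for \<open>2j + 2\<close>.\<close>

lemma rd_diff_even:
  "int (rd_o (2 * m)) - int (rd_e (2 * m))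
     = (\<Sum>j<m. signed_sum j j (2 * (m - j - 1) + 1) 1 - signed_sum j j (2 * (m - j - 1)) 1)"
  unfolding rd_diff_eq_sum_signed_sum sum_odd_even_pairs
proof (intro sum.cong refl)
  fix j assume "j \<in> {..<m}"
  then have r: "2 * m - (2 * j + 1) = 2 * (m - j - 1) + 1" "2 * m - (2 * j + 2) = 2 * (m - j - 1)"
    by auto
  show "signed_sum (card {x\<in>{1..<2 * j + 1}. odd x}) (card {x\<in>{1..<2 * j + 1}. even x})
        (2 * m - (2 * j + 1)) (if odd (2 * j + 1) then 1 else - 1)
      + signed_sum (card {x\<in>{1..<2 * j + 2}. odd x}) (card {x\<in>{1..<2 * j + 2}. even x})
        (2 * m - (2 * j + 2)) (if odd (2 * j + 2) then 1 else - 1)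
      = signed_sum j j (2 * (m - j - 1) + 1) 1 - signed_sum j j (2 * (m - j - 1)) 1"
    unfolding r using card_odd_even_less[of j] card_odd_even_less_Suc[of j]
    by (simp only: signed_sum_Suc) (simp add: signed_sum_Suc)
qed

text \<open>The parities of the remaining counts are exchanged here, and the largest part
  \<open>2m + 1\<close> is left without a partner; it belongs to the partition with a single
  part.\<close>

lemma rd_diff_odd:
  "int (rd_o (2 * m + 1)) - int (rd_e (2 * m + 1))
     = (\<Sum>j<m. signed_sum j j (2 * (m - j)) 1 - signed_sum j j (2 * (m - j - 1) + 1) 1)
       + signed_sum m m 0 1"
proof -
  let ?U = "\<lambda>k. signed_sum (card {x\<in>{1..<k}. odd x}) (card {x\<in>{1..<k}. even x}) (2 * m + 1 - k)
      (if odd k then 1 else - 1)"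
  have "(\<Sum>k=1..2 * m + 1. ?U k) = (\<Sum>k=1..2 * m. ?U k) + ?U (2 * m + 1)" by simp
  also have "(\<Sum>k=1..2 * m. ?U k)
      = (\<Sum>j<m. signed_sum j j (2 * (m - j)) 1 - signed_sum j j (2 * (m - j - 1) + 1) 1)"
    unfolding sum_odd_even_pairs
  proof (intro sum.cong refl)
    fix j assume "j \<in> {..<m}"
    then have r: "2 * m + 1 - (2 * j + 1) = 2 * (m - j)"
      "2 * m + 1 - (2 * j + 2) = 2 * (m - j - 1) + 1"
      by auto
    show "?U (2 * j + 1) + ?U (2 * j + 2)
        = signed_sum j j (2 * (m - j)) 1 - signed_sum j j (2 * (m - j - 1) + 1) 1"
      unfolding r using card_odd_even_less[of j] card_odd_even_less_Suc[of j]
      by (simp only: signed_sum_Suc) (simp add: signed_sum_Suc)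
  qed
  also have "?U (2 * m + 1) = signed_sum m m 0 1"
    using card_odd_even_less[of m] by simp
  finally show ?thesis unfolding rd_diff_eq_sum_signed_sum .
qed

section \<open>Comparison with the binomial series\<close>

lemma binom_diff:
  assumes "j < m"
  shows "binom n (int m - int j) = int (n choose (m - j))"
    and "binom n (int m - int j - 1) = int (n choose (m - j - 1))"
proof -
  have "nat (int m - int j) = m - j" "nat (int m - int j - 1) = m - j - 1" by linarith+
  with assms show "binom n (int m - int j) = int (n choose (m - j))"
    "binom n (int m - int j - 1) = int (n choose (m - j - 1))"
    by (simp_all add: binom_def)
qed

theorem theorem4p2:
  fixes m :: nat
  shows "(\<lambda>n. binom n (int m - int n - 1)
              * (binom n (int m - int n) - binom n (int m - int n - 1)))
           sums (int (rd_o (2 * m)) - int (rd_e (2 * m)))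
       \<and> (\<lambda>n. binom n (int m - int n)
              * (binom n (int m - int n) - binom n (int m - int n - 1)))
           sums (int (rd_o (2 * m + 1)) - int (rd_e (2 * m + 1)))"
proof
  let ?f = "\<lambda>n. binom n (int m - int n - 1)
    * (binom n (int m - int n) - binom n (int m - int n - 1))"
  have "?f sums (\<Sum>j<m. ?f j)"
    \<comment> \<open>For \<open>n \<ge> m\<close> the lower index \<open>m - n - 1\<close> of the
      first factor is negative.\<close>
    by (rule sums_finite) (auto simp: binom_def)
  also have "(\<Sum>j<m. ?f j) = int (rd_o (2 * m)) - int (rd_e (2 * m))"
    unfolding rd_diff_even
    \<comment> \<open>With \<open>s = m - j - 1\<close> the closed forms leave the product of
      \<open>j choose s\<close> and \<open>(j choose (s + 1)) - (j choose s)\<close>.\<close>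
    by (intro sum.cong refl, unfold signed_sum_even signed_sum_odd)
      (simp add: binom_diff Suc_diff_Suc power2_eq_square right_diff_distrib mult.commute)
  finally show "?f sums (int (rd_o (2 * m)) - int (rd_e (2 * m)))" .
next
  let ?g = "\<lambda>n. binom n (int m - int n)
    * (binom n (int m - int n) - binom n (int m - int n - 1))"
  have "?g sums (\<Sum>j<Suc m. ?g j)"
    by (rule sums_finite) (auto simp: binom_def)
  \<comment> \<open>The term for \<open>n = m\<close> is \<open>1 * (1 - 0)\<close>, since the index
    -1 gives 0; it matches \<open>signed_sum m m 0 1\<close>.\<close>
  also have "(\<Sum>j<Suc m. ?g j) = (\<Sum>j<m. ?g j) + 1"
    by (simp add: binom_def)
  also have "\<dots> = int (rd_o (2 * m + 1)) - int (rd_e (2 * m + 1))"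
    unfolding rd_diff_odd
    by (intro arg_cong2[where f = "(+)"] sum.cong refl, unfold signed_sum_even signed_sum_odd)
      (simp_all add: binom_diff Suc_diff_Suc signed_sum_def power2_eq_square right_diff_distrib mult.commute)
  finally show "?g sums (int (rd_o (2 * m + 1)) - int (rd_e (2 * m + 1)))" .
qed

end
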